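(* Let $x_0,\check x\in\mathbb R^2$ be fixed. Assume (N1)–(N3), (K1)–(K3) with $M>\nu+1$, and (X1)–(X2), where $\nu$ is the type in (X1). Then, as $\epsilon\to0$, $$\frac{\sum_{k}\sum_{j}\bigl|\mathcal H\varphi'(a_k-j+\vec\alpha_k\cdot\check x)\bigr|^3\,\mathbb E|\eta_{k,j}|^3}{\Bigl[\sum_{k}\sum_{j}\bigl(\mathcal H\varphi'(a_k-j+\vec\alpha_k\cdot\check x)\bigr)^2\,\mathbb E\eta_{k,j}^2\Bigr]^{3/2}}=O(\epsilon^{1/2}).$$
   Context: Fix $\kappa>0$ and $\bar p\in\mathbb R$. For $\epsilon>0$ set $\Delta p=\epsilon$, $\Delta\alpha=\kappa\epsilon$, $\alpha_k=k\Delta\alpha$, $p_j=\bar p+j\epsilon$ ($k,j\in\mathbb Z$), and $\vec\alpha=(\cos\alpha,\sin\alpha)$. Sums over $k$ range over all $k\in\mathbb Z$ with $|\alpha_k|\le\pi$; sums over $j$ range over $\mathbb Z$. Noise: for each $\epsilon$, $\{\eta_{k,j}\}$ are independent real random variables (not necessarily identically distributed) with (N1) $\mathbb E\eta_{k,j}=0$; (N2) $\mathbb E\eta_{k,j}^2=\sigma^2(\alpha_k,p_j)\Delta\alpha$, where $\sigma$ is a fixed real function of $(\alpha,p)$, $2\pi$-periodic in $\alpha$, of class $C^1$, bounded with bounded first partial derivatives on the relevant domain; (N3) $\mathbb E|\eta_{k,j}|^3\le c(\Delta\alpha)^{3/2}$ with $c$ independent of $k,j,\epsilon$. Kernel $\varphi:\mathbb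 R\to\mathbb R$: (K1) compactly supported; (K2) $\varphi^{(M+1)}\in L^\infty(\mathbb R)$ for some integer $M\ge3$; (K3) $\int\varphi=1$. $\mathcal H$ is the Hilbert transform, $\mathcal Hg(t)=\frac1\pi\,\mathrm{p.v.}\!\int\frac{g(s)}{t-s}ds$, and $\mathcal H\varphi'$ is the Hilbert transform of $\varphi'$. For $x_0\in\mathbb R^2$ set $a_k=(\vec\alpha_k\cdot x_0-\bar p)/\epsilon$. For $r\in\mathbb R$, $\langle r\rangle=\operatorname{dist}(r,\mathbb Z)$. An irrational $s$ is of type $\nu>0$ if for every $\nu_1>\nu$ there is $c(s,\nu_1)>0$ with $m^{\nu_1}\langle ms\rangle\ge c(s,\nu_1)$ for all $m\in\mathbb N$. Assumptions on $x_0$: (X1) $\kappa|x_0|$ is irrational and of some finite type $\nu$; (X2) $\sigma^2(\alpha,\vec\alpha\cdot x_0)\neq0$ for all $\alpha$ in some nonempty open set $\Omega\subset[0,2\pi]$. *)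

theory Defs
  imports "HOL-Probability.Probability" "HOL-Library.Landau_Symbols"
begin

definition dirvec :: "real \<Rightarrow> real^2" where
  "dirvec a = vector [cos a, sin a]"

definition dist_int :: "real \<Rightarrow> real" where
  "dist_int r = infdist r \<int>"

definition irrational_of_type :: "real \<Rightarrow> real \<Rightarrow> bool" where
  "irrational_of_type s \<nu> \<longleftrightarrow> s \<notin> \<rat> \<and>
     (\<forall>\<nu>1 > \<nu>. \<exists>c > 0. \<forall>m::nat. m \<ge> 1 \<longrightarrow> real m powr \<nu>1 * dist_int (real m * s) \<ge> c)"

definition hilbert_transform :: "(real \<Rightarrow> real) \<Rightarrow> real \<Rightarrow> real" where
  "hilbert_transform g t =
     Lim (at_right 0) (\<lambda>\<delta>. integral {s. \<delta> \<le> \<bar>t - s\<bar>} (\<lambda>s. g s / (t - s))) / pi"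

definition idxK :: "real \<Rightarrow> real \<Rightarrow> int set" where
  "idxK \<kappa> \<epsilon> = {k. \<bar>real_of_int k * (\<kappa> * \<epsilon>)\<bar> \<le> pi}"

end

theory Submission
  imports Defs
begin

text \<open>
  The kernel \<open>\<psi> = H\<phi>'\<close> is bounded and, because \<open>\<integral>\<phi> = 1\<close>, satisfies \<open>\<psi>(t) \<sim> -1/(\<pi> t\<^sup>2)\<close> at infinity.
  Hence \<open>\<Sum>\<^sub>j \<bar>\<psi>(t - j)\<bar>\<^sup>3\<close> is bounded uniformly in \<open>t\<close>, and the numerator, with \<open>O(1/\<epsilon>)\<close> values
  of \<open>k\<close> and third moments \<open>O(\<epsilon>\<^bsup>3/2\<^esup>)\<close>, is \<open>O(\<epsilon>\<^bsup>1/2\<^esup>)\<close>. For the denominator it suffices to keep, for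
  each \<open>k\<close>, the single \<open>j\<close> whose argument falls into a fixed interval \<open>[T, T + 1]\<close> on which \<open>\<psi>\<close> is
  bounded away from zero. There \<open>p\<^sub>j\<close> is within \<open>O(\<epsilon>)\<close> of \<open>\<alpha>\<^sub>k \<cdot> x\<^sub>0\<close>, so \<open>\<sigma>\<close> is bounded away from zero
  for all \<open>\<alpha>\<^sub>k\<close> near a point of \<open>\<Omega>\<close>; there are at least a constant times \<open>1/\<epsilon>\<close> such \<open>k\<close>, each
  contributing at least a constant times \<open>\<epsilon>\<close>.
\<close>

section \<open>Principal values for compactly supported functions\<close>

lemma difference_quotient_bound:
  fixes g g' :: "real \<Rightarrow> real"
  assumes "\<And>x. (g has_real_derivative g' x) (at x)" "\<And>x. \<bar>g' x\<bar> \<le> B"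
  shows "\<bar>g x - g y\<bar> \<le> B * \<bar>x - y\<bar>"
  using field_differentiable_bound[of UNIV g g' B x y] assms by auto

text \<open>The antiderivative is \<open>- ln (s - t)\<close>. The value is the negative of the one
  on the mirror interval to the left of \<open>t\<close>, so the singular parts cancel in a
  principal value.\<close>

lemma integral_inverse_right:
  fixes t \<delta> A :: real
  assumes "0 < \<delta>" "\<delta> \<le> A"
  shows "((\<lambda>s. 1 / (t - s)) has_integral (ln \<delta> - ln A)) {t + \<delta>..t + A}"
proof -
  have "((\<lambda>s. 1 / (t - s)) has_integral (- ln ((t + A) - t) - (- ln ((t + \<delta>) - t)))) {t + \<delta>..t + A}"
  proof (rule fundamental_theorem_of_calculus)
    fix x assume "x \<in> {t + \<delta>..t + A}"
    then have "x - t > 0" using assms by auto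
    then show "((\<lambda>s. - ln (s - t)) has_vector_derivative 1 / (t - x)) (at x within {t + \<delta>..t + A})"
      unfolding has_real_derivative_iff_has_vector_derivative[symmetric]
      by (auto intro!: derivative_eq_intros simp: divide_simps)
  qed (use assms in auto)
  then show ?thesis by simp
qed

lemma integral_inverse_left:
  fixes t \<delta> A :: real
  assumes "0 < \<delta>" "\<delta> \<le> A"
  shows "((\<lambda>s. 1 / (t - s)) has_integral (ln A - ln \<delta>)) {t - A..t - \<delta>}"
proof -
  have "((\<lambda>s. 1 / (t - s)) has_integral (- ln (t - (t - \<delta>)) - (- ln (t - (t - A))))) {t - A..t - \<delta>}"
  proof (rule fundamental_theorem_of_calculus)
    fix x assume "x \<in> {t - A..t - \<delta>}"
    then have "t - x > 0" using assms by auto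
    then show "((\<lambda>s. - ln (t - s)) has_vector_derivative 1 / (t - x)) (at x within {t - A..t - \<delta>})"
      unfolding has_real_derivative_iff_has_vector_derivative[symmetric]
      by (auto intro!: derivative_eq_intros simp: divide_simps)
  qed (use assms in auto)
  then show ?thesis by simp
qed

text \<open>Extended by zero, both integrands are the same function. This turns the unbounded domain
  of a truncated principal value into bounded intervals.\<close>

lemma integral_eq_on_support:
  fixes f :: "'n::euclidean_space \<Rightarrow> 'b::banach"
  assumes "\<And>s. f s \<noteq> 0 \<Longrightarrow> s \<in> S \<longleftrightarrow> s \<in> T"
  shows "integral S f = integral T f"
proof -
  have "(\<lambda>s. if s \<in> S then f s else 0) = (\<lambda>s. if s \<in> T then f s else 0)"
    using assms by (intro ext) metis
  then show ?thesis
    using integral_restrict_UNIV[of S f] integral_restrict_UNIV[of T f] by simp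
qed

text \<open>Away from \<open>s = t\<close> the integrand is \<open>g t / (t - s)\<close> minus the
  difference quotient of \<open>g\<close>. On a window symmetric about \<open>t\<close> the first
  part integrates to zero once a symmetric gap is cut out, and the second is bounded by
  \<open>B\<close>. The transform is therefore minus the integral of the difference quotient over
  the window, divided by \<open>pi\<close>.\<close>

lemma hilbert_transform_bound:
  fixes g g' :: "real \<Rightarrow> real"
  assumes deriv: "\<And>x. (g has_real_derivative g' x) (at x)" and B: "\<And>x. \<bar>g' x\<bar> \<le> B"
    and supp: "\<And>x. R \<le> \<bar>x\<bar> \<Longrightarrow> g x = 0" and R: "R > 0"
  shows "\<bar>hilbert_transform g t\<bar> \<le> 2 * (\<bar>t\<bar> + R) * B / pi"
proof -
  \<comment> \<open>Half the width of a window centred at \<open>t\<close> that contains the support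
    \<open>[-R, R]\<close>.\<close>
  define A where "A = \<bar>t\<bar> + R"
  have A: "A > 0" using R by (simp add: A_def)
  \<comment> \<open>The difference quotient, extended continuously through
    \<open>s = t\<close>.\<close>
  define q where "q s = (if s = t then g' t else (g s - g t) / (s - t))" for s
  have q_le: "\<bar>q s\<bar> \<le> B" for s
    using difference_quotient_bound[OF deriv B, of s t] B[of t]
    by (auto simp: q_def divide_simps abs_mult)
  have B0: "B \<ge> 0" using B[of 0] by linarith
  have q_cont: "continuous_on S q" for S
  proof -
    have "isCont q s" for s
    proof (cases "s = t")
      case True
      have "((\<lambda>s. (g s - g t) / (s - t)) \<longlongrightarrow> g' t) (at t)"
        using deriv[of t] by (simp add: has_field_derivative_iff)
      then have "(q \<longlongrightarrow> g' t) (at t)"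
        by (rule Lim_transform_eventually)
          (auto simp: q_def eventually_at_filter)
      then show ?thesis using True by (simp add: isCont_def q_def)
    next
      case False
      have "isCont g s" using deriv DERIV_isCont by blast
      then have c: "isCont (\<lambda>s. (g s - g t) / (s - t)) s"
        using False by (auto intro!: continuous_intros)
      have "\<forall>\<^sub>F x in nhds s. x \<noteq> t" using False by (rule t1_space_nhds)
      then have "\<forall>\<^sub>F x in nhds s. q x = (g x - g t) / (x - t)"
        by eventually_elim (simp add: q_def)
      from isCont_cong[OF this] c show ?thesis by simp
    qed
    then show ?thesis by (simp add: continuous_at_imp_continuous_on)
  qed
  have q_int: "q integrable_on {a..b}" for a b
    by (rule integrable_continuous_interval[OF q_cont])
  define I where "I = integral {t - A..t + A} q"
  define V where "V \<delta> = integral {s. \<delta> \<le> \<bar>t - s\<bar>} (\<lambda>s. g s / (t - s))" for \<delta>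
  \<comment> \<open>The sum \<open>V \<delta> + I\<close> is exactly the integral of
    \<open>q\<close> over the gap \<open>[t - \<delta>, t + \<delta>]\<close>, hence tends to zero
    with \<delta>.\<close>
  have V_eq: "\<bar>V \<delta> + I\<bar> \<le> B * (2 * \<delta>)" if "0 < \<delta>" "\<delta> < A" for \<delta>
  proof -
    let ?f = "\<lambda>s. g s / (t - s)"
    have fq: "g t * (1 / (t - s)) - q s = ?f s" if "s \<noteq> t" for s
      using that by (simp add: q_def field_simps)
    have 1: "(?f has_integral (g t * (ln A - ln \<delta>) - integral {t - A..t - \<delta>} q)) {t - A..t - \<delta>}"
      by (rule has_integral_eq[OF _ has_integral_diff[OF has_integral_mult_right[OF integral_inverse_left]
              integrable_integral[OF q_int]]])
        (rule fq, use that in auto)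
    have 2: "(?f has_integral (g t * (ln \<delta> - ln A) - integral {t + \<delta>..t + A} q)) {t + \<delta>..t + A}"
      by (rule has_integral_eq[OF _ has_integral_diff[OF has_integral_mult_right[OF integral_inverse_right]
              integrable_integral[OF q_int]]])
        (rule fq, use that in auto)
    have disj: "{t - A..t - \<delta>} \<inter> {t + \<delta>..t + A} = {}" using that by auto
    have "(?f has_integral (g t * (ln A - ln \<delta>) - integral {t - A..t - \<delta>} q
        + (g t * (ln \<delta> - ln A) - integral {t + \<delta>..t + A} q))) ({t - A..t - \<delta>} \<union> {t + \<delta>..t + A})"
      by (rule has_integral_Un[OF 1 2]) (simp only: disj negligible_empty)
    then have 3: "integral ({t - A..t - \<delta>} \<union> {t + \<delta>..t + A}) ?f
        = - integral {t - A..t - \<delta>} q - integral {t + \<delta>..t + A} q"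
      by (simp add: integral_unique algebra_simps)
    have "V \<delta> = integral ({t - A..t - \<delta>} \<union> {t + \<delta>..t + A}) ?f"
      unfolding V_def
    proof (rule integral_eq_on_support)
      fix s assume "g s / (t - s) \<noteq> 0"
      then have "\<not> R \<le> \<bar>s\<bar>" using supp by auto
      then have "t - A \<le> s" "s \<le> t + A" by (auto simp: A_def)
      then show "s \<in> {s. \<delta> \<le> \<bar>t - s\<bar>} \<longleftrightarrow> s \<in> {t - A..t - \<delta>} \<union> {t + \<delta>..t + A}"
        using that by auto
    qed
    moreover have "integral {t - A..t - \<delta>} q + integral {t - \<delta>..t + \<delta>} q = integral {t - A..t + \<delta>} q"
      by (rule Henstock_Kurzweil_Integration.integral_combine) (use that q_int in auto)
    moreover have "integral {t - A..t + \<delta>} q + integral {t + \<delta>..t + A} q = I"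
      unfolding I_def by (rule Henstock_Kurzweil_Integration.integral_combine) (use that q_int in auto)
    ultimately have "V \<delta> + I = integral {t - \<delta>..t + \<delta>} q" using 3 by linarith
    moreover have "norm (integral {t - \<delta>..t + \<delta>} q) \<le> B * ((t + \<delta>) - (t - \<delta>))"
      by (rule integral_bound) (use that q_cont q_le in auto)
    ultimately show ?thesis by simp
  qed
  have "(V \<longlongrightarrow> - I) (at_right 0)"
  proof (rule LIM_zero_cancel, rule Lim_null_comparison)
    show "\<forall>\<^sub>F \<delta> in at_right 0. norm (V \<delta> - - I) \<le> B * (2 * \<delta>)"
      using eventually_at_right_real[OF A] by eventually_elim (use V_eq in auto)
    show "((\<lambda>\<delta>. B * (2 * \<delta>)) \<longlongrightarrow> 0) (at_right 0)"
      by (auto intro!: tendsto_eq_intros)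
  qed
  \<comment> \<open>\<open>Lim\<close> is a definite description, so its value is available only now
    that convergence has been proved.\<close>
  then have "hilbert_transform g t = - I / pi"
    unfolding hilbert_transform_def V_def by (subst tendsto_Lim) auto
  moreover have "norm I \<le> B * ((t + A) - (t - A))"
    unfolding I_def by (rule integral_bound) (use A q_cont q_le in auto)
  ultimately show ?thesis
    by (simp add: A_def divide_right_mono algebra_simps)
qed

text \<open>Once \<delta> is below \<open>|t| - R\<close>, the removed gap misses the support, so
  the truncated integrals are constant in \<delta>.\<close>

lemma hilbert_transform_outside_support:
  assumes supp: "\<And>x. R \<le> \<bar>x\<bar> \<Longrightarrow> g x = 0" and t: "R < \<bar>t\<bar>"
  shows "hilbert_transform g t = integral {-R..R} (\<lambda>s. g s / (t - s)) / pi"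
proof -
  define V where "V \<delta> = integral {s. \<delta> \<le> \<bar>t - s\<bar>} (\<lambda>s. g s / (t - s))" for \<delta>
  have "V \<delta> = integral {-R..R} (\<lambda>s. g s / (t - s))" if "\<delta> < \<bar>t\<bar> - R" for \<delta>
    unfolding V_def
  proof (rule integral_eq_on_support)
    fix s assume "g s / (t - s) \<noteq> 0"
    then have "\<not> R \<le> \<bar>s\<bar>" using supp by auto
    then show "s \<in> {s. \<delta> \<le> \<bar>t - s\<bar>} \<longleftrightarrow> s \<in> {-R..R}"
      using that by auto
  qed
  then have "\<forall>\<^sub>F \<delta> in at_right 0. V \<delta> = integral {-R..R} (\<lambda>s. g s / (t - s))"
    using eventually_at_right_real[of 0 "\<bar>t\<bar> - R"] t by (auto elim!: eventually_mono)
  then have "(V \<longlongrightarrow> integral {-R..R} (\<lambda>s. g s / (t - s))) (at_right 0)"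
    by (rule tendsto_eventually)
  then show ?thesis
    unfolding hilbert_transform_def V_def by (subst tendsto_Lim) auto
qed

text \<open>Integration by parts: \<open>f s / (t - s)\<close> vanishes at both ends of
  \<open>[-R, R]\<close>, and moving the derivative to the kernel gains one power of decay in
  \<open>t\<close>.\<close>

lemma hilbert_transform_deriv_outside_support:
  assumes deriv: "\<And>x. (f has_real_derivative f' x) (at x)" and cont: "continuous_on UNIV f'"
    and supp: "\<And>x. R \<le> \<bar>x\<bar> \<Longrightarrow> f x = 0" "\<And>x. R \<le> \<bar>x\<bar> \<Longrightarrow> f' x = 0"
    and R: "R > 0" and t: "R < \<bar>t\<bar>"
  shows "hilbert_transform f' t = - integral {-R..R} (\<lambda>s. f s / (t - s)\<^sup>2) / pi"
proof -
  have ne: "t - s \<noteq> 0" if "s \<in> {-R..R}" for s using that t by auto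
  have contf: "continuous_on S f" for S
    using deriv DERIV_isCont continuous_at_imp_continuous_on by blast
  have contf': "continuous_on S f'" for S using cont continuous_on_subset by blast
  have "((\<lambda>s. f' s / (t - s) + f s / (t - s)\<^sup>2) has_integral (f R / (t - R) - f (-R) / (t - - R))) {-R..R}"
  proof (rule fundamental_theorem_of_calculus)
    fix x assume "x \<in> {-R..R}"
    then have "t - x \<noteq> 0" by (rule ne)
    then show "((\<lambda>s. f s / (t - s)) has_vector_derivative f' x / (t - x) + f x / (t - x)\<^sup>2) (at x within {-R..R})"
      unfolding has_real_derivative_iff_has_vector_derivative[symmetric]
      by (auto intro!: derivative_eq_intros DERIV_subset[OF deriv] simp: add_divide_distrib power2_eq_square)
  qed (use R in auto)
  then have "integral {-R..R} (\<lambda>s. f' s / (t - s) + f s / (t - s)\<^sup>2) = 0"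
    using R by (simp add: supp integral_unique)
  moreover have "integral {-R..R} (\<lambda>s. f' s / (t - s) + f s / (t - s)\<^sup>2)
      = integral {-R..R} (\<lambda>s. f' s / (t - s)) + integral {-R..R} (\<lambda>s. f s / (t - s)\<^sup>2)"
    by (rule Henstock_Kurzweil_Integration.integral_add)
      (use ne in \<open>auto intro!: integrable_continuous_interval continuous_intros contf contf'\<close>)
  ultimately have "integral {-R..R} (\<lambda>s. f' s / (t - s)) = - integral {-R..R} (\<lambda>s. f s / (t - s)\<^sup>2)"
    by linarith
  then show ?thesis
    using hilbert_transform_outside_support[of R f' t] supp t by simp
qed

section \<open>Decay and non-vanishing of the transformed derivative\<close>

lemma compact_support_bounded:
  fixes f :: "real \<Rightarrow> real"
  assumes "continuous_on UNIV f" "\<And>x. R \<le> \<bar>x\<bar> \<Longrightarrow> f x = 0"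
  obtains B where "B > 0" "\<And>x. \<bar>f x\<bar> \<le> B"
proof -
  have "bounded (f ` {-R..R})"
    by (meson assms(1) compact_Icc compact_continuous_image compact_imp_bounded continuous_on_subset subset_UNIV)
  then obtain B where "B > 0" "\<And>x. x \<in> {-R..R} \<Longrightarrow> \<bar>f x\<bar> \<le> B"
    by (auto simp: bounded_pos)
  moreover have "\<bar>f x\<bar> \<le> B" for x
  proof (cases "R \<le> \<bar>x\<bar>")
    case True
    then show ?thesis using assms(2) calculation(1) by simp
  next
    case False
    then have "x \<in> {-R..R}" by auto
    then show ?thesis by (rule calculation(2))
  qed
  ultimately show ?thesis using that by blast
qed

text \<open>Split at \<open>|t| = 2 * R\<close>. Inside, the principal value bound applies to
  \<open>f'\<close>, with \<open>f''\<close> as its derivative. Outside, \<open>|t - s|\<close> is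
  at least \<open>|t| / 2\<close> on the support, so the squared kernel is at most
  \<open>4 / t^2\<close>.\<close>

lemma hilbert_transform_deriv_decay:
  assumes deriv: "\<And>x. (f has_real_derivative f' x) (at x)" "\<And>x. (f' has_real_derivative f'' x) (at x)"
    and cont: "continuous_on UNIV f''"
    and supp: "\<And>x. R \<le> \<bar>x\<bar> \<Longrightarrow> f x = 0" "\<And>x. R \<le> \<bar>x\<bar> \<Longrightarrow> f' x = 0" "\<And>x. R \<le> \<bar>x\<bar> \<Longrightarrow> f'' x = 0"
    and R: "R \<ge> 1"
  obtains C where "C > 0" "\<And>t. \<bar>hilbert_transform f' t\<bar> \<le> C / (1 + t\<^sup>2)"
proof -
  have contf: "continuous_on S f" "continuous_on S f'" for S
    using deriv DERIV_isCont continuous_at_imp_continuous_on by blast+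
  obtain B where B: "B > 0" "\<And>x. \<bar>f'' x\<bar> \<le> B" using compact_support_bounded[OF cont supp(3)] by blast
  obtain D where D: "D > 0" "\<And>x. \<bar>f x\<bar> \<le> D" using compact_support_bounded[OF contf(1) supp(1)] by blast
  \<comment> \<open>One summand per range of \<open>t\<close>. For \<open>|t| \<le> 2 * R\<close>
    the transform is at most \<open>6 * R * B\<close>. Beyond, it is at most
    \<open>8 * D * R / t^2\<close>, while \<open>1 + t^2\<close> is at most
    \<open>2 * t^2\<close>.\<close>
  define C where "C = 6 * R * B * (1 + (2 * R)\<^sup>2) + 16 * D * R"
  have C: "C > 0" using B D R by (auto simp: C_def intro!: add_pos_pos mult_pos_pos)
  have "\<bar>hilbert_transform f' t\<bar> * (1 + t\<^sup>2) \<le> C" for t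
  proof (cases "\<bar>t\<bar> \<le> 2 * R")
    case True
    have "\<bar>hilbert_transform f' t\<bar> \<le> 2 * (\<bar>t\<bar> + R) * B / pi"
      by (rule hilbert_transform_bound[OF deriv(2) B(2) supp(2)]) (use R in auto)
    also have "\<dots> \<le> 2 * (\<bar>t\<bar> + R) * B / 1"
      by (rule divide_left_mono) (use B R pi_gt3 in auto)
    also have "\<dots> \<le> 6 * R * B" using True B by (simp add: mult_right_mono)
    finally have 1: "\<bar>hilbert_transform f' t\<bar> \<le> 6 * R * B" .
    have "t\<^sup>2 \<le> (2 * R)\<^sup>2" using True R by (metis abs_ge_zero power2_abs power_mono)
    then have "\<bar>hilbert_transform f' t\<bar> * (1 + t\<^sup>2) \<le> (6 * R * B) * (1 + (2 * R)\<^sup>2)"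
      using 1 B R by (intro mult_mono) auto
    also have "\<dots> \<le> C" using D R by (simp add: C_def)
    finally show ?thesis .
  next
    case False
    then have t: "\<bar>t\<bar> > 2 * R" by simp
    have dom: "\<bar>f s / (t - s)\<^sup>2\<bar> \<le> D * 4 / t\<^sup>2" if "s \<in> {-R..R}" for s
    proof -
      have "\<bar>t\<bar> / 2 \<le> \<bar>t - s\<bar>" using that t by (auto simp: abs_if)
      then have "(\<bar>t\<bar> / 2)\<^sup>2 \<le> \<bar>t - s\<bar>\<^sup>2" by (rule power_mono) auto
      then have "t\<^sup>2 / 4 \<le> (t - s)\<^sup>2" by (simp add: power_divide)
      then have "\<bar>f s\<bar> / (t - s)\<^sup>2 \<le> D / (t\<^sup>2 / 4)"
        using D t R by (intro frac_le) auto
      then show ?thesis by simp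
    qed
    have ne: "t - s \<noteq> 0" if "s \<in> {-R..R}" for s using that t R by auto
    have "norm (integral {-R..R} (\<lambda>s. f s / (t - s)\<^sup>2)) \<le> D * 4 / t\<^sup>2 * (R - - R)"
      by (rule integral_bound) (use R ne dom in \<open>auto intro!: continuous_intros contf\<close>)
    then have "\<bar>hilbert_transform f' t\<bar> \<le> D * 4 / t\<^sup>2 * (2 * R) / pi"
      using hilbert_transform_deriv_outside_support[OF deriv(1) contf(2) supp(1,2), of R t] t R
      by (simp add: divide_right_mono del: times_divide_eq_left)
    also have "\<dots> \<le> D * 4 / t\<^sup>2 * (2 * R) / 1"
      by (rule divide_left_mono) (use D R pi_gt3 in auto)
    finally have 1: "\<bar>hilbert_transform f' t\<bar> \<le> 8 * D * R / t\<^sup>2" by simp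
    have "1\<^sup>2 \<le> \<bar>t\<bar>\<^sup>2" using t R by (intro power_mono) auto
    then have t1: "1 \<le> t\<^sup>2" by simp
    have "\<bar>hilbert_transform f' t\<bar> * (1 + t\<^sup>2) \<le> 8 * D * R / t\<^sup>2 * (2 * t\<^sup>2)"
      using 1 t1 D R by (intro mult_mono) auto
    also have "\<dots> = 16 * D * R" using t1 by auto
    also have "\<dots> \<le> C" using B R by (simp add: C_def)
    finally show ?thesis .
  qed
  then have "\<bar>hilbert_transform f' t\<bar> \<le> C / (1 + t\<^sup>2)" for t
    by (simp add: pos_le_divide_eq add_pos_nonneg)
  then show ?thesis using that C by blast
qed

text \<open>Because \<open>f\<close> has integral 1, \<open>t^2\<close> times the integral of
  \<open>f s / (t - s)^2\<close> tends to 1. Beyond \<open>T\<close> the deviation is at most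
  \<open>1 / 2\<close>, which leaves half of the leading term.\<close>

lemma hilbert_transform_deriv_lower_bound:
  assumes deriv: "\<And>x. (f has_real_derivative f' x) (at x)" and cont: "continuous_on UNIV f'"
    and supp: "\<And>x. R \<le> \<bar>x\<bar> \<Longrightarrow> f x = 0" "\<And>x. R \<le> \<bar>x\<bar> \<Longrightarrow> f' x = 0"
    and R: "R \<ge> 1" and int: "(f has_integral 1) UNIV"
  obtains T where "T > 0" "\<And>t. T \<le> t \<Longrightarrow> 1 / (2 * pi * t\<^sup>2) \<le> \<bar>hilbert_transform f' t\<bar>"
proof -
  have contf: "continuous_on S f" for S
    using deriv DERIV_isCont continuous_at_imp_continuous_on by blast
  obtain D where D: "D > 0" "\<And>x. \<bar>f x\<bar> \<le> D" using compact_support_bounded[OF contf supp(1)] by blast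
  \<comment> \<open>The first summand gives \<open>t - s \<ge> t / 2\<close> on the support. The
    second makes the total error \<open>24 * R^2 * D / t\<close> at most
    \<open>1 / 2\<close>.\<close>
  define T where "T = 2 * R + 48 * R\<^sup>2 * D"
  have T: "T \<ge> 2 * R" "T > 0" using D R by (auto simp: T_def intro!: add_pos_pos)
  have "1 / (2 * pi * t\<^sup>2) \<le> \<bar>hilbert_transform f' t\<bar>" if tT: "T \<le> t" for t
  proof -
    have t: "t \<ge> 2 * R" "t > 0" using tT T by auto
    have t48: "t \<ge> 48 * R\<^sup>2 * D" using tT R by (simp add: T_def)
    have ne: "t - s \<noteq> 0" if "s \<in> {-R..R}" for s using that t R by auto
    have int1: "integral {-R..R} f = 1"
    proof -
      have "(\<lambda>s. if s \<in> {-R..R} then f s else 0) = f" using supp(1) by force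
      then show ?thesis using int by (metis integral_restrict_UNIV integral_unique)
    qed
    \<comment> \<open>The left side is \<open>|f s|\<close> times
      \<open>|s * (2 * t - s)| / (t - s)^2\<close>. That numerator is at most
      \<open>3 * R * t\<close> and the denominator at least \<open>t^2 / 4\<close>.\<close>
    have dom: "\<bar>t\<^sup>2 * (f s / (t - s)\<^sup>2) - f s\<bar> \<le> D * (12 * R / t)" if s: "s \<in> {-R..R}" for s
    proof -
      have "t / 2 \<le> t - s" using s t by auto
      then have "(t / 2)\<^sup>2 \<le> (t - s)\<^sup>2" using t by (intro power_mono) auto
      then have q: "t\<^sup>2 / 4 \<le> (t - s)\<^sup>2" by (simp add: power_divide)
      have "\<bar>2 * t - s\<bar> \<le> 3 * t" "\<bar>s\<bar> \<le> R" using s t R by auto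
      then have "\<bar>s\<bar> * \<bar>2 * t - s\<bar> \<le> R * (3 * t)" using t R by (intro mult_mono) auto
      then have "\<bar>s * (2 * t - s)\<bar> / (t - s)\<^sup>2 \<le> (R * (3 * t)) / (t\<^sup>2 / 4)"
        using q t R by (intro frac_le) (auto simp: abs_mult)
      also have "\<dots> = 12 * R / t" using t by (simp add: field_simps power2_eq_square)
      finally have "\<bar>f s\<bar> * (\<bar>s * (2 * t - s)\<bar> / (t - s)\<^sup>2) \<le> D * (12 * R / t)"
        using D(1) D(2)[of s] by (intro mult_mono) auto
      moreover have "s * (2 * t - s) = t\<^sup>2 - (t - s)\<^sup>2"
        by (simp add: algebra_simps power2_eq_square)
      then have "t\<^sup>2 * (f s / (t - s)\<^sup>2) - f s = f s * (s * (2 * t - s) / (t - s)\<^sup>2)"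
        using ne[OF s] by (simp add: diff_divide_distrib right_diff_distrib)
      ultimately show ?thesis by (simp add: abs_mult)
    qed
    define J where "J = integral {-R..R} (\<lambda>s. f s / (t - s)\<^sup>2)"
    have "integral {-R..R} (\<lambda>s. t\<^sup>2 * (f s / (t - s)\<^sup>2) - f s)
        = integral {-R..R} (\<lambda>s. t\<^sup>2 * (f s / (t - s)\<^sup>2)) - integral {-R..R} f"
      by (rule Henstock_Kurzweil_Integration.integral_diff)
        (use ne in \<open>auto intro!: integrable_continuous_interval continuous_intros contf\<close>)
    then have "integral {-R..R} (\<lambda>s. t\<^sup>2 * (f s / (t - s)\<^sup>2) - f s) = t\<^sup>2 * J - 1"
      using int1 by (simp add: J_def del: times_divide_eq_right)
    moreover have "norm (integral {-R..R} (\<lambda>s. t\<^sup>2 * (f s / (t - s)\<^sup>2) - f s)) \<le> D * (12 * R / t) * (R - - R)"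
      by (rule integral_bound) (use R ne dom in \<open>auto intro!: continuous_intros contf\<close>)
    moreover have "D * (12 * R / t) * (R - - R) \<le> 1 / 2"
      using t t48 by (simp add: field_simps power2_eq_square)
    ultimately have "t\<^sup>2 * J \<ge> 1 / 2" by (simp add: abs_le_iff)
    then have "J \<ge> 1 / (2 * t\<^sup>2)" using t by (simp add: field_simps)
    moreover have "hilbert_transform f' t = - (J / pi)"
      using hilbert_transform_deriv_outside_support[OF deriv cont supp, of R t] R t
      by (simp add: J_def)
    ultimately have "1 / (2 * t\<^sup>2) / pi \<le> \<bar>hilbert_transform f' t\<bar>"
      using divide_right_mono[of "1 / (2 * t\<^sup>2)" J pi] pi_gt_zero by linarith
    then show ?thesis by (simp add: ac_simps)
  qed
  then show ?thesis using that T by blast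
qed

section \<open>Lattice sums and counting\<close>

text \<open>Replacing \<open>t\<close> by its floor changes each term by a factor of at most 3, and
  the sum then runs over distinct integers, independently of where \<open>t\<close> lies.\<close>

lemma sum_shifted_inverse_squares_bounded:
  obtains S :: real where "S > 0"
    "\<And>t J. finite J \<Longrightarrow> (\<Sum>j\<in>J. 1 / (1 + (t - real_of_int j)\<^sup>2)) \<le> S"
proof -
  define w :: "int \<Rightarrow> real" where "w i = 1 / (1 + (real_of_int i)\<^sup>2)" for i
  have w_nonneg: "w i \<ge> 0" for i by (simp add: w_def)
  have sn: "summable (\<lambda>n. w (int n))"
  proof (rule summable_comparison_test')
    show "summable (\<lambda>n. inverse (real n ^ 2))" by (rule inverse_power_summable) simp
    \<comment> \<open>The comparison starts at 1: at \<open>n = 0\<close> the right side is 0 by the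
      convention for \<open>inverse\<close>, whereas \<open>w 0 = 1\<close>.\<close>
    show "norm (w (int n)) \<le> inverse (real n ^ 2)" if "1 \<le> n" for n
      using that by (auto simp: w_def inverse_eq_divide intro!: frac_le)
  qed
  define W where "W = (\<Sum>n. w (int n))"
  have W: "W \<ge> 0" unfolding W_def using sn w_nonneg by (rule suminf_nonneg)
  have wsum: "sum w I \<le> 2 * W" if "finite I" for I
  proof -
    have le: "sum w (int ` N) \<le> W" "sum w ((\<lambda>n. - int n) ` N) \<le> W" if "finite N" for N
    proof -
      have "sum (\<lambda>n. w (int n)) N \<le> W"
        unfolding W_def using sn that w_nonneg by (intro sum_le_suminf) auto
      moreover have "sum w (int ` N) = sum (\<lambda>n. w (int n)) N"
        by (subst sum.reindex) auto
      moreover have "sum w ((\<lambda>n. - int n) ` N) = sum (\<lambda>n. w (int n)) N"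
        by (subst sum.reindex) (auto simp: inj_on_def w_def)
      ultimately show "sum w (int ` N) \<le> W" "sum w ((\<lambda>n. - int n) ` N) \<le> W" by auto
    qed
    define N where "N = (\<lambda>i. nat \<bar>i\<bar>) ` I"
    have fN: "finite N" using that by (simp add: N_def)
    \<comment> \<open>The two signed copies overlap at 0, which is harmless for an upper
      bound.\<close>
    have "I \<subseteq> int ` N \<union> (\<lambda>n. - int n) ` N"
    proof
      fix i assume "i \<in> I"
      then have "nat \<bar>i\<bar> \<in> N" by (simp add: N_def)
      moreover have "i = int (nat \<bar>i\<bar>) \<or> i = - int (nat \<bar>i\<bar>)" by auto
      ultimately show "i \<in> int ` N \<union> (\<lambda>n. - int n) ` N" by blast
    qed
    then have "sum w I \<le> sum w (int ` N \<union> (\<lambda>n. - int n) ` N)"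
      using fN w_nonneg by (intro sum_mono2) auto
    also have "\<dots> \<le> sum w (int ` N) + sum w ((\<lambda>n. - int n) ` N)"
      using sum_nonneg[of "int ` N \<inter> (\<lambda>n. - int n) ` N" w] fN w_nonneg by (simp add: sum_Un)
    also have "\<dots> \<le> 2 * W" using le[OF fN] by simp
    finally show ?thesis .
  qed
  \<comment> \<open>Two signs and the factor 3 give \<open>6 * W\<close>; the extra 1 makes the
    constant strictly positive.\<close>
  have bound: "(\<Sum>j\<in>J. 1 / (1 + (t - real_of_int j)\<^sup>2)) \<le> 6 * W + 1" if "finite J" for t :: real and J
  proof -
    have le: "1 / (1 + (t - real_of_int j)\<^sup>2) \<le> 3 * w (\<lfloor>t\<rfloor> - j)" for j
    proof -
      define x where "x = t - real_of_int j"
      define i where "i = real_of_int (\<lfloor>t\<rfloor> - j)"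
      have d: "0 \<le> x - i" "x - i \<le> 1" 
        by (simp_all add: x_def i_def) linarith
      have "(x - i)\<^sup>2 \<le> 1\<^sup>2" using d by (intro power_mono) auto
      \<comment> \<open>This square encodes \<open>i^2 \<le> 2 * x^2 + 2 * (x - i)^2\<close>, the
        source of the factor 3.\<close>
      moreover have "2 * x\<^sup>2 + 2 * (x - i)\<^sup>2 - i\<^sup>2 = (2 * x - i)\<^sup>2"
        by (simp add: power2_eq_square algebra_simps)
      ultimately have "i\<^sup>2 \<le> 2 * x\<^sup>2 + 2"
        using zero_le_power2[of "2 * x - i"] unfolding power_one by linarith
      then have "i\<^sup>2 \<le> 2 + 3 * x\<^sup>2" by (rule order_trans) simp
      then have "1 + i\<^sup>2 \<le> 3 * (1 + x\<^sup>2)" by simp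
      moreover have "0 < 1 + i\<^sup>2" "0 < 1 + x\<^sup>2" by (auto simp: add_pos_nonneg)
      ultimately have "1 / (1 + x\<^sup>2) \<le> 3 * (1 / (1 + i\<^sup>2))" by (simp add: field_simps)
      then show ?thesis by (simp add: w_def x_def i_def)
    qed
    have "(\<Sum>j\<in>J. 1 / (1 + (t - real_of_int j)\<^sup>2)) \<le> (\<Sum>j\<in>J. 3 * w (\<lfloor>t\<rfloor> - j))"
      by (rule sum_mono) (rule le)
    also have "\<dots> = 3 * sum w ((\<lambda>j. \<lfloor>t\<rfloor> - j) ` J)"
      by (subst sum.reindex) (auto simp: inj_on_def sum_distrib_left)
    also have "\<dots> \<le> 6 * W + 1" using wsum[of "(\<lambda>j. \<lfloor>t\<rfloor> - j) ` J"] that by simp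
    finally show ?thesis .
  qed
  show ?thesis using that[of "6 * W + 1"] bound W by simp
qed

text \<open>A finite subset lies in a finite rectangle with side \<open>K\<close>. By nonnegativity
  its sum is at most that over the rectangle, where each row contributes at most
  \<open>b\<close>.\<close>

lemma infsum_bounded_on_product:
  fixes F :: "'k \<times> 'j \<Rightarrow> real"
  assumes K: "finite K" and nonneg: "\<And>k j. k \<in> K \<Longrightarrow> F (k, j) \<ge> 0"
    and bound: "\<And>k J. k \<in> K \<Longrightarrow> finite J \<Longrightarrow> (\<Sum>j\<in>J. F (k, j)) \<le> b"
  shows "F summable_on (K \<times> UNIV)" "infsum F (K \<times> UNIV) \<le> real (card K) * b"
proof -
  have fin: "sum F X \<le> real (card K) * b" if "finite X" "X \<subseteq> K \<times> UNIV" for X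
  proof -
    have "X \<subseteq> K \<times> (snd ` X)" using that by force
    then have "sum F X \<le> sum F (K \<times> (snd ` X))"
      using that K nonneg by (intro sum_mono2) auto
    also have "\<dots> = (\<Sum>k\<in>K. \<Sum>j\<in>snd ` X. F (k, j))" by (simp add: sum.cartesian_product)
    also have "\<dots> \<le> (\<Sum>k\<in>K. b)" using bound that by (intro sum_mono) auto
    finally show ?thesis by simp
  qed
  show s: "F summable_on (K \<times> UNIV)"
  proof (rule nonneg_bdd_above_summable_on)
    show "bdd_above (sum F ` {X. X \<subseteq> K \<times> UNIV \<and> finite X})"
      using fin by (auto intro!: bdd_aboveI2)
  qed (use nonneg in auto)
  show "infsum F (K \<times> UNIV) \<le> real (card K) * b"
    using s fin by (rule infsum_le_finite_sums)
qed

text \<open>The set is an integer interval whose real endpoints are \<open>2 * r / h\<close> apart;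
  rounding costs at most 1 either way.\<close>

lemma card_int_multiples_near:
  fixes a r h :: real
  assumes "h > 0" "r \<ge> 0"
  shows "finite {k::int. \<bar>real_of_int k * h - a\<bar> \<le> r}"
    "2 * r / h - 1 \<le> real (card {k::int. \<bar>real_of_int k * h - a\<bar> \<le> r})"
    "real (card {k::int. \<bar>real_of_int k * h - a\<bar> \<le> r}) \<le> 2 * r / h + 1"
proof -
  have eq: "{k::int. \<bar>real_of_int k * h - a\<bar> \<le> r} = {\<lceil>(a - r) / h\<rceil>..\<lfloor>(a + r) / h\<rfloor>}"
    using assms by (auto simp: ceiling_le_iff le_floor_iff field_simps abs_le_iff)
  show "finite {k::int. \<bar>real_of_int k * h - a\<bar> \<le> r}" unfolding eq by simp
  have e: "(a + r) / h - (a - r) / h = 2 * r / h" by (simp flip: diff_divide_distrib)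
  have p: "2 * r / h \<ge> 0" using assms by simp
  \<comment> \<open>Nonnegativity is needed because the cardinality of an integer interval is
    truncated at 0.\<close>
  have "\<lfloor>(a + r) / h\<rfloor> - \<lceil>(a - r) / h\<rceil> + 1 \<ge> 0"
    using e p by linarith
  then have c: "real (card {k::int. \<bar>real_of_int k * h - a\<bar> \<le> r})
      = real_of_int (\<lfloor>(a + r) / h\<rfloor> - \<lceil>(a - r) / h\<rceil> + 1)"
    unfolding eq by simp
  show "2 * r / h - 1 \<le> real (card {k::int. \<bar>real_of_int k * h - a\<bar> \<le> r})"
    "real (card {k::int. \<bar>real_of_int k * h - a\<bar> \<le> r}) \<le> 2 * r / h + 1"
    unfolding c using e by (simp; linarith)+
qed

section \<open>Directions, supports of derivatives and Lipschitz bounds\<close>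

lemma dirvec_periodic: "dirvec (a - 2 * pi) = dirvec a"
  by (simp add: dirvec_def cos_diff sin_diff)

lemma continuous_on_dirvec_inner: "continuous_on UNIV (\<lambda>a. dirvec a \<bullet> x)"
  by (auto simp: dirvec_def inner_vec_def sum_2 intro!: continuous_intros)

lemma abs_dirvec_inner_le: "\<bar>dirvec a \<bullet> x\<bar> \<le> norm x"
proof -
  have "norm (dirvec a) = 1"
    by (simp add: dirvec_def norm_eq_sqrt_inner inner_vec_def sum_2 flip: power2_eq_square)
  then show ?thesis using Cauchy_Schwarz_ineq2[of "dirvec a" x] by simp
qed


text \<open>The strict inequality describes an open set, so \<open>f\<close> is constant near
  \<open>x\<close>.\<close>

lemma derivative_vanishes_outside_support:
  fixes f f' :: "real \<Rightarrow> real"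
  assumes "\<And>x. (f has_real_derivative f' x) (at x)" "\<And>x. R < \<bar>x\<bar> \<Longrightarrow> f x = 0" "R < \<bar>x\<bar>"
  shows "f' x = 0"
proof (rule DERIV_local_const[OF assms(1)])
  show "0 < \<bar>x\<bar> - R" using assms(3) by simp
  show "\<forall>y. \<bar>x - y\<bar> < \<bar>x\<bar> - R \<longrightarrow> f x = f y"
  proof (intro allI impI)
    fix y assume "\<bar>x - y\<bar> < \<bar>x\<bar> - R"
    then have "R < \<bar>y\<bar>" by linarith
    then show "f x = f y" using assms(2,3) by simp
  qed
qed

text \<open>Go from \<open>(a, p)\<close> to \<open>(a', p')\<close> through \<open>(a', p)\<close>
  and use the mean value bound on each leg.\<close>

lemma bounded_partials_imp_lipschitz:
  fixes \<sigma> :: "real \<Rightarrow> real \<Rightarrow> real"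
  assumes da: "\<And>a p. ((\<lambda>a'. \<sigma> a' p) has_real_derivative \<sigma>a a p) (at a)"
    and dp: "\<And>a p. ((\<lambda>p'. \<sigma> a p') has_real_derivative \<sigma>p a p) (at p)"
    and ba: "bounded (range (\<lambda>z::real\<times>real. \<sigma>a (fst z) (snd z)))"
    and bp: "bounded (range (\<lambda>z::real\<times>real. \<sigma>p (fst z) (snd z)))"
  obtains L where "L > 0" "\<And>a p a' p'. \<bar>\<sigma> a p - \<sigma> a' p'\<bar> \<le> L * (\<bar>a - a'\<bar> + \<bar>p - p'\<bar>)"
proof -
  obtain L1 where L1: "L1 > 0" "\<And>a p. \<bar>\<sigma>a a p\<bar> \<le> L1"
    using ba by (auto simp: bounded_pos)
  obtain L2 where L2: "L2 > 0" "\<And>a p. \<bar>\<sigma>p a p\<bar> \<le> L2"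
    using bp by (auto simp: bounded_pos)
  have "\<bar>\<sigma> a p - \<sigma> a' p'\<bar> \<le> (L1 + L2) * (\<bar>a - a'\<bar> + \<bar>p - p'\<bar>)" for a p a' p'
  proof -
    have "\<bar>\<sigma> a p - \<sigma> a' p\<bar> \<le> L1 * \<bar>a - a'\<bar>"
      by (rule difference_quotient_bound[OF da L1(2)])
    moreover have "\<bar>\<sigma> a' p - \<sigma> a' p'\<bar> \<le> L2 * \<bar>p - p'\<bar>"
      by (rule difference_quotient_bound[OF dp L2(2)])
    moreover have "0 \<le> L1 * \<bar>p - p'\<bar>" "0 \<le> L2 * \<bar>a - a'\<bar>" using L1 L2 by auto
    ultimately show ?thesis unfolding distrib_left distrib_right by linarith
  qed
  then show ?thesis using that[of "L1 + L2"] L1 L2 by simp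
qed

theorem theorem1:
  fixes \<kappa> pbar c \<nu> :: real
    and \<sigma> \<sigma>\<^sub>\<alpha> \<sigma>\<^sub>p :: "real \<Rightarrow> real \<Rightarrow> real"
    and \<phi> :: "real \<Rightarrow> real" and M :: nat
    and x0 xc :: "real^2"
    and P :: "real \<Rightarrow> 'a measure"
    and \<eta> :: "real \<Rightarrow> int \<Rightarrow> int \<Rightarrow> 'a \<Rightarrow> real"
  assumes kappa_pos: "\<kappa> > 0"
    \<comment> \<open>regularity of sigma\<close>
    and sigma_periodic: "\<And>a p. \<sigma> (a + 2 * pi) p = \<sigma> a p"
    and sigma_da: "\<And>a p. ((\<lambda>a'. \<sigma> a' p) has_real_derivative \<sigma>\<^sub>\<alpha> a p) (at a)"
    and sigma_dp: "\<And>a p. ((\<lambda>p'. \<sigma> a p') has_real_derivative \<sigma>\<^sub>p a p) (at p)"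
    and sigma_da_cont: "continuous_on UNIV (\<lambda>z::real\<times>real. \<sigma>\<^sub>\<alpha> (fst z) (snd z))"
    and sigma_dp_cont: "continuous_on UNIV (\<lambda>z::real\<times>real. \<sigma>\<^sub>p (fst z) (snd z))"
    and sigma_bdd: "bounded (range (\<lambda>z::real\<times>real. \<sigma> (fst z) (snd z)))"
    and sigma_da_bdd: "bounded (range (\<lambda>z::real\<times>real. \<sigma>\<^sub>\<alpha> (fst z) (snd z)))"
    and sigma_dp_bdd: "bounded (range (\<lambda>z::real\<times>real. \<sigma>\<^sub>p (fst z) (snd z)))"
    \<comment> \<open>noise (N1)-(N3), including independence\<close>
    and noise: "\<And>\<epsilon>. \<epsilon> > 0 \<Longrightarrow>
       prob_space (P \<epsilon>) \<and>
       prob_space.indep_vars (P \<epsilon>) (\<lambda>_. borel) (\<lambda>(k, j). \<eta> \<epsilon> k j) (idxK \<kappa> \<epsilon> \<times> UNIV) \<and>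
       (\<forall>k \<in> idxK \<kappa> \<epsilon>. \<forall>j.
          \<eta> \<epsilon> k j \<in> borel_measurable (P \<epsilon>) \<and>
          integrable (P \<epsilon>) (\<eta> \<epsilon> k j) \<and>
          integrable (P \<epsilon>) (\<lambda>x. (\<eta> \<epsilon> k j x)\<^sup>2) \<and>
          integrable (P \<epsilon>) (\<lambda>x. \<bar>\<eta> \<epsilon> k j x\<bar> ^ 3) \<and>
          (\<integral>x. \<eta> \<epsilon> k j x \<partial>P \<epsilon>) = 0 \<and>
          (\<integral>x. (\<eta> \<epsilon> k j x)\<^sup>2 \<partial>P \<epsilon>) =
             (\<sigma> (real_of_int k * (\<kappa> * \<epsilon>)) (pbar + real_of_int j * \<epsilon>))\<^sup>2 * (\<kappa> * \<epsilon>) \<and>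
          (\<integral>x. \<bar>\<eta> \<epsilon> k j x\<bar> ^ 3 \<partial>P \<epsilon>) \<le> c * (\<kappa> * \<epsilon>) powr (3/2))"
    \<comment> \<open>kernel (K1)-(K3)\<close>
    and K1: "\<exists>R. \<forall>t. \<bar>t\<bar> > R \<longrightarrow> \<phi> t = 0"
    and M_ge: "M \<ge> 3"
    and K2_diff: "\<And>k t. k < M \<Longrightarrow> ((deriv ^^ k) \<phi> has_real_derivative (deriv ^^ Suc k) \<phi> t) (at t)"
    and K2_lip: "\<exists>L. \<forall>s t. \<bar>(deriv ^^ M) \<phi> s - (deriv ^^ M) \<phi> t\<bar> \<le> L * \<bar>s - t\<bar>"
    and K3: "(\<phi> has_integral 1) UNIV"
    \<comment> \<open>(X1), (X2), and M > nu + 1\<close>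
    and nu_pos: "\<nu> > 0"
    and X1: "irrational_of_type (\<kappa> * norm x0) \<nu>"
    and M_nu: "real M > \<nu> + 1"
    and X2: "\<exists>\<Omega>. open \<Omega> \<and> \<Omega> \<noteq> {} \<and> \<Omega> \<subseteq> {0..2*pi} \<and>
               (\<forall>a\<in>\<Omega>. (\<sigma> a (dirvec a \<bullet> x0))\<^sup>2 \<noteq> 0)"
  shows
    "let H = (\<lambda>\<epsilon> k j. hilbert_transform (deriv \<phi>)
               ((dirvec (real_of_int k * (\<kappa> * \<epsilon>)) \<bullet> x0 - pbar) / \<epsilon> - real_of_int j
                + dirvec (real_of_int k * (\<kappa> * \<epsilon>)) \<bullet> xc));
         Num = (\<lambda>\<epsilon> (k, j). \<bar>H \<epsilon> k j\<bar> ^ 3 * (\<integral>x. \<bar>\<eta> \<epsilon> k j x\<bar> ^ 3 \<partial>P \<epsilon>));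
         Den = (\<lambda>\<epsilon> (k, j). (H \<epsilon> k j)\<^sup>2 * (\<integral>x. (\<eta> \<epsilon> k j x)\<^sup>2 \<partial>P \<epsilon>))
     in (\<forall>\<^sub>F \<epsilon> in at_right 0. Num \<epsilon> summable_on (idxK \<kappa> \<epsilon> \<times> UNIV) \<and>
                               Den \<epsilon> summable_on (idxK \<kappa> \<epsilon> \<times> UNIV)) \<and>
        (\<lambda>\<epsilon>. infsum (Num \<epsilon>) (idxK \<kappa> \<epsilon> \<times> UNIV)
              / (infsum (Den \<epsilon>) (idxK \<kappa> \<epsilon> \<times> UNIV)) powr (3/2))
          \<in> O[at_right 0](\<lambda>\<epsilon>. sqrt \<epsilon>)"
proof -

  \<comment> \<open>Kernel estimates\<close>
  define \<psi> where "\<psi> = hilbert_transform (deriv \<phi>)"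
  define t where "t \<epsilon> k = (dirvec (real_of_int k * (\<kappa> * \<epsilon>)) \<bullet> x0 - pbar) / \<epsilon>
    + dirvec (real_of_int k * (\<kappa> * \<epsilon>)) \<bullet> xc" for \<epsilon> k
  define Num where "Num \<epsilon> = (\<lambda>(k, j). \<bar>\<psi> (t \<epsilon> k - real_of_int j)\<bar> ^ 3 * (\<integral>x. \<bar>\<eta> \<epsilon> k j x\<bar> ^ 3 \<partial>P \<epsilon>))" for \<epsilon>
  define Den where "Den \<epsilon> = (\<lambda>(k, j). (\<psi> (t \<epsilon> k - real_of_int j))\<^sup>2 * (\<integral>x. (\<eta> \<epsilon> k j x)\<^sup>2 \<partial>P \<epsilon>))" for \<epsilon>

  obtain R0 where R0: "\<And>x. \<bar>x\<bar> > R0 \<Longrightarrow> \<phi> x = 0" using K1 by blast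
  \<comment> \<open>The added 1 makes \<open>R \<le> |x|\<close> imply the strict
    \<open>R0 < |x|\<close>, as the vanishing of the derivatives requires.\<close>
  define R where "R = \<bar>R0\<bar> + 1"
  have RR0: "\<bar>x\<bar> > R0" if "R \<le> \<bar>x\<bar>" for x :: real
    using that by (auto simp: R_def)
  have R: "R \<ge> 1" by (simp add: R_def)
  have D1: "(\<phi> has_real_derivative deriv \<phi> x) (at x)" for x
    using K2_diff[of 0 x] M_ge by simp
  have D2: "(deriv \<phi> has_real_derivative deriv (deriv \<phi>) x) (at x)" for x
    using K2_diff[of 1 x] M_ge by simp
  have D3: "(deriv (deriv \<phi>) has_real_derivative deriv (deriv (deriv \<phi>)) x) (at x)" for x
    using K2_diff[of 2 x] M_ge by (simp add: numeral_2_eq_2)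
  have cont1: "continuous_on UNIV (deriv \<phi>)"
    using D2 DERIV_isCont continuous_at_imp_continuous_on by blast
  have cont2: "continuous_on UNIV (deriv (deriv \<phi>))"
    using D3 DERIV_isCont continuous_at_imp_continuous_on by blast
  have V1: "deriv \<phi> x = 0" if "\<bar>x\<bar> > R0" for x
    by (rule derivative_vanishes_outside_support[OF D1 R0 that])
  have V2: "deriv (deriv \<phi>) x = 0" if "\<bar>x\<bar> > R0" for x
    by (rule derivative_vanishes_outside_support[OF D2 V1 that])
  have supp: "\<phi> x = 0" "deriv \<phi> x = 0" "deriv (deriv \<phi>) x = 0" if "R \<le> \<bar>x\<bar>" for x
    using R0 V1 V2 RR0[OF that] by auto
  obtain C where C: "C > 0" "\<And>u. \<bar>\<psi> u\<bar> \<le> C / (1 + u\<^sup>2)"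
    unfolding \<psi>_def by (rule hilbert_transform_deriv_decay[OF D1 D2 cont2 supp R]) blast+
  obtain T where T: "T > 0" "\<And>u. T \<le> u \<Longrightarrow> 1 / (2 * pi * u\<^sup>2) \<le> \<bar>\<psi> u\<bar>"
    unfolding \<psi>_def by (rule hilbert_transform_deriv_lower_bound[OF D1 cont1 supp(1,2) R K3]) blast+
  obtain S :: real where S: "S > 0"
    "\<And>u J. finite J \<Longrightarrow> (\<Sum>j\<in>J. 1 / (1 + (u - real_of_int j)\<^sup>2)) \<le> S"
    by (rule sum_shifted_inverse_squares_bounded) blast
  \<comment> \<open>The weight \<open>1 / (1 + u^2)\<close> is at most 1, so its powers are below
    it; one lattice sum then serves both squares and cubes.\<close>
  have \<psi>_pow: "\<bar>\<psi> u\<bar> ^ n \<le> C ^ n * (1 / (1 + u\<^sup>2))" if "n > 0" for u n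
  proof -
    define v where "v = 1 / (1 + u\<^sup>2)"
    have v: "0 \<le> v" "v \<le> 1" by (auto simp: v_def add_pos_nonneg)
    have "\<bar>\<psi> u\<bar> ^ n \<le> (C * v) ^ n" using C(2)[of u] by (intro power_mono) (auto simp: v_def)
    also have "\<dots> = C ^ n * v ^ n" by (rule power_mult_distrib)
    also have "\<dots> \<le> C ^ n * v"
      using C v that power_decreasing[of 1 n v] by (intro mult_left_mono) auto
    finally show ?thesis by (simp add: v_def)
  qed

  \<comment> \<open>Noise level, base angle and constants\<close>
  obtain Q where Q: "Q > 0" "\<And>a p. \<bar>\<sigma> a p\<bar> \<le> Q"
    using sigma_bdd by (auto simp: bounded_pos)
  obtain L where L: "L > 0" "\<And>a p a' p'. \<bar>\<sigma> a p - \<sigma> a' p'\<bar> \<le> L * (\<bar>a - a'\<bar> + \<bar>p - p'\<bar>)"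
    by (rule bounded_partials_imp_lipschitz[OF sigma_da sigma_dp sigma_da_bdd sigma_dp_bdd]) blast

  \<comment> \<open>A strict inequality leaves room for a neighbourhood inside
    \<open>[-pi, pi]\<close>. An open set is not a singleton, so \<Omega> has a point other than
    \<open>pi\<close>; a point beyond \<open>pi\<close> is shifted by one period.\<close>
  obtain a0 where a0: "\<bar>a0\<bar> < pi" "\<sigma> a0 (dirvec a0 \<bullet> x0) \<noteq> 0"
  proof -
    obtain \<Omega> where \<Omega>: "open \<Omega>" "\<Omega> \<noteq> {}" "\<Omega> \<subseteq> {0..2*pi}"
      "\<And>a. a \<in> \<Omega> \<Longrightarrow> (\<sigma> a (dirvec a \<bullet> x0))\<^sup>2 \<noteq> 0" using X2 by blast
    have "\<Omega> \<noteq> {pi}" using \<Omega>(1) not_open_singleton by blast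
    then obtain a where a: "a \<in> \<Omega>" "a \<noteq> pi" using \<Omega>(2) by blast
    have ran: "0 \<le> a" "a \<le> 2 * pi" using \<Omega>(3) a(1) by auto
    have nz: "\<sigma> a (dirvec a \<bullet> x0) \<noteq> 0" using \<Omega>(4)[OF a(1)] by simp
    show thesis
    proof (cases "a < pi")
      case True
      then show ?thesis using that[of a] ran nz by simp
    next
      case False
      then show ?thesis
        using that[of "a - 2 * pi"] a(2) ran nz sigma_periodic[of "a - 2 * pi"]
        by (simp add: dirvec_periodic abs_less_iff)
    qed
  qed
  define m where "m = \<bar>\<sigma> a0 (dirvec a0 \<bullet> x0)\<bar>"
  have m: "m > 0" using a0 by (simp add: m_def)
  \<comment> \<open>Three errors of size at most \<open>d\<close> (in the angle, in the projection
    on \<open>x0\<close>, in the lattice point \<open>p\<close>) change \<sigma> by at most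
    \<open>3 * d * L = m / 2\<close>.\<close>
  define d where "d = m / (6 * L)"
  have d: "d > 0" using m L by (simp add: d_def)
  have "isCont (\<lambda>a. dirvec a \<bullet> x0) a0"
    using continuous_on_dirvec_inner[of x0] by (simp add: continuous_on_eq_continuous_at)
  then obtain r where r: "r > 0" "\<And>a. \<bar>a - a0\<bar> < r \<Longrightarrow> \<bar>dirvec a \<bullet> x0 - dirvec a0 \<bullet> x0\<bar> < d"
    using d unfolding continuous_at_eps_delta by (metis dist_real_def)
  \<comment> \<open>The entries give, in order: the continuity bound at \<open>a0\<close>, an angle
    error of at most \<open>d\<close>, and angles within \<open>[-pi, pi]\<close>.\<close>
  define \<rho> where "\<rho> = min (r / 2) (min d (pi - \<bar>a0\<bar>))"
  have \<rho>: "\<rho> > 0" "\<rho> < r" "\<rho> \<le> d" "\<bar>a0\<bar> + \<rho> \<le> pi" using r d a0 by (auto simp: \<rho>_def)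
  \<comment> \<open>Bounds \<open>dirvec a \<bullet> xc - u\<close> for \<open>u\<close> in
    \<open>[T, T + 1]\<close>.\<close>
  define E where "E = T + 1 + norm xc"
  have E: "E > 0" using T norm_ge_zero[of xc] unfolding E_def by linarith
  \<comment> \<open>With step \<open>h = \<kappa> * \<epsilon>\<close> this yields
    \<open>\<epsilon> * E \<le> d\<close>, \<open>h \<le> \<rho>\<close> and
    \<open>h \<le> 1\<close>. The last two absorb the rounding terms in the counts of
    angles.\<close>
  define \<epsilon>0 where "\<epsilon>0 = min (d / E) (min (\<rho> / \<kappa>) (1 / \<kappa>))"
  have \<epsilon>0: "\<epsilon>0 > 0" using d E \<rho> kappa_pos by (simp add: \<epsilon>0_def)
  define c0 where "c0 = 1 / (2 * pi * (T + 1)\<^sup>2)"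
  have c0: "c0 > 0" using T by (simp add: c0_def)
  \<comment> \<open>At least \<open>\<rho> / h\<close> angles contribute at least
    \<open>c0^2 * (m / 2)^2 * h\<close> each; the step \<open>h\<close> cancels.\<close>
  define c1 where "c1 = \<rho> * (c0\<^sup>2 * (m / 2)\<^sup>2)"
  have c1: "c1 > 0" using c0 m \<rho> by (simp add: c1_def)
  define c2 where "c2 = (2 * pi + 1) * (C ^ 3 * \<bar>c\<bar> * S)"

  \<comment> \<open>Uniform bounds for numerator and denominator\<close>
  have main: "Num \<epsilon> summable_on (idxK \<kappa> \<epsilon> \<times> UNIV) \<and> Den \<epsilon> summable_on (idxK \<kappa> \<epsilon> \<times> UNIV)
      \<and> 0 \<le> infsum (Num \<epsilon>) (idxK \<kappa> \<epsilon> \<times> UNIV)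
      \<and> infsum (Num \<epsilon>) (idxK \<kappa> \<epsilon> \<times> UNIV) \<le> c2 * sqrt (\<kappa> * \<epsilon>)
      \<and> c1 \<le> infsum (Den \<epsilon>) (idxK \<kappa> \<epsilon> \<times> UNIV)" if \<epsilon>: "0 < \<epsilon>" "\<epsilon> < \<epsilon>0" for \<epsilon>
  proof -
    define h where "h = \<kappa> * \<epsilon>"
    have h: "0 < h" "h \<le> \<rho>" "h \<le> 1" and \<epsilon>E: "\<epsilon> * E \<le> d"
      using \<epsilon> kappa_pos E by (auto simp: h_def \<epsilon>0_def field_simps)
    have K: "finite (idxK \<kappa> \<epsilon>)" "real (card (idxK \<kappa> \<epsilon>)) \<le> 2 * pi / h + 1"
      using card_int_multiples_near[of h pi 0] h by (simp_all add: idxK_def h_def)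
    have var: "(\<integral>x. (\<eta> \<epsilon> k j x)\<^sup>2 \<partial>P \<epsilon>) = (\<sigma> (real_of_int k * h) (pbar + real_of_int j * \<epsilon>))\<^sup>2 * h"
      and third: "(\<integral>x. \<bar>\<eta> \<epsilon> k j x\<bar> ^ 3 \<partial>P \<epsilon>) \<le> c * h powr (3/2)"
      if "k \<in> idxK \<kappa> \<epsilon>" for k j
      using noise[OF \<epsilon>(1)] that unfolding h_def by blast+
    have third_nonneg: "0 \<le> (\<integral>x. \<bar>\<eta> \<epsilon> k j x\<bar> ^ 3 \<partial>P \<epsilon>)" for k j by simp
    have Num_nonneg: "0 \<le> Num \<epsilon> (k, j)" and Den_nonneg: "0 \<le> Den \<epsilon> (k, j)" for k j
      by (simp_all add: Num_def Den_def)
    have Num_sum: "(\<Sum>j\<in>J. Num \<epsilon> (k, j)) \<le> C ^ 3 * \<bar>c\<bar> * h powr (3/2) * S"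
      if "k \<in> idxK \<kappa> \<epsilon>" "finite J" for k J
    proof -
      have "c * h powr (3/2) \<le> \<bar>c\<bar> * h powr (3/2)" by (intro mult_right_mono) auto
      then have "(\<integral>x. \<bar>\<eta> \<epsilon> k j x\<bar> ^ 3 \<partial>P \<epsilon>) \<le> \<bar>c\<bar> * h powr (3/2)" for j
        using third[OF that(1), of j] by linarith
      then have "Num \<epsilon> (k, j) \<le> (C ^ 3 * (1 / (1 + (t \<epsilon> k - real_of_int j)\<^sup>2))) * (\<bar>c\<bar> * h powr (3/2))" for j
        unfolding Num_def prod.case using C(1)
        by (intro mult_mono \<psi>_pow third_nonneg) auto
      then have "(\<Sum>j\<in>J. Num \<epsilon> (k, j))
          \<le> (\<Sum>j\<in>J. (C ^ 3 * \<bar>c\<bar> * h powr (3/2)) * (1 / (1 + (t \<epsilon> k - real_of_int j)\<^sup>2)))"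
        by (intro sum_mono) (simp add: ac_simps)
      also have "\<dots> = (C ^ 3 * \<bar>c\<bar> * h powr (3/2)) * (\<Sum>j\<in>J. 1 / (1 + (t \<epsilon> k - real_of_int j)\<^sup>2))"
        by (rule sum_distrib_left[symmetric])
      also have "\<dots> \<le> (C ^ 3 * \<bar>c\<bar> * h powr (3/2)) * S"
        using C(1) S(2)[OF that(2)] by (intro mult_left_mono) auto
      finally show ?thesis .
    qed
    \<comment> \<open>This upper bound secures summability: a divergent \<open>infsum\<close> is 0
      by default, and no lower bound could then hold.\<close>
    have Den_sum: "(\<Sum>j\<in>J. Den \<epsilon> (k, j)) \<le> C ^ 2 * Q\<^sup>2 * h * S"
      if "k \<in> idxK \<kappa> \<epsilon>" "finite J" for k J
    proof -
      have "(\<sigma> a p)\<^sup>2 \<le> Q\<^sup>2" for a p using Q(2)[of a p] by (metis abs_ge_zero power2_abs power_mono)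
      then have "(\<integral>x. (\<eta> \<epsilon> k j x)\<^sup>2 \<partial>P \<epsilon>) \<le> Q\<^sup>2 * h" for j
        unfolding var[OF that(1)] using h by (intro mult_right_mono) auto
      then have "Den \<epsilon> (k, j) \<le> (C ^ 2 * (1 / (1 + (t \<epsilon> k - real_of_int j)\<^sup>2))) * (Q\<^sup>2 * h)" for j
        unfolding Den_def prod.case using C(1) \<psi>_pow[of 2]
        by (intro mult_mono) auto
      then have "(\<Sum>j\<in>J. Den \<epsilon> (k, j))
          \<le> (\<Sum>j\<in>J. (C ^ 2 * Q\<^sup>2 * h) * (1 / (1 + (t \<epsilon> k - real_of_int j)\<^sup>2)))"
        by (intro sum_mono) (simp add: ac_simps)
      also have "\<dots> = (C ^ 2 * Q\<^sup>2 * h) * (\<Sum>j\<in>J. 1 / (1 + (t \<epsilon> k - real_of_int j)\<^sup>2))"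
        by (rule sum_distrib_left[symmetric])
      also have "\<dots> \<le> (C ^ 2 * Q\<^sup>2 * h) * S"
        using C(1) h S(2)[OF that(2)] by (intro mult_left_mono) auto
      finally show ?thesis .
    qed
    note Num_bound = infsum_bounded_on_product[OF K(1) Num_nonneg Num_sum]
    note Den_bound = infsum_bounded_on_product[OF K(1) Den_nonneg Den_sum]
    have "infsum (Num \<epsilon>) (idxK \<kappa> \<epsilon> \<times> UNIV) \<le> c2 * sqrt h"
    proof -
      have "2 * pi / h + 1 \<le> (2 * pi + 1) / h" using h by (simp add: field_simps)
      then have "real (card (idxK \<kappa> \<epsilon>)) * (C ^ 3 * \<bar>c\<bar> * h powr (3/2) * S)
          \<le> (2 * pi + 1) / h * (C ^ 3 * \<bar>c\<bar> * h powr (3/2) * S)"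
        using K(2) C(1) S(1) by (intro mult_right_mono) auto
      also have "\<dots> = c2 * (h powr (3/2) / h)" by (simp add: c2_def)
      \<comment> \<open>Order \<open>1 / h\<close> angles against third moments of order
        \<open>h powr (3/2)\<close>: this is where the rate comes from.\<close>
      also have "h powr (3/2) / h = sqrt h"
        using h powr_diff[of h "3/2" 1] by (simp add: powr_half_sqrt)
      finally show ?thesis using Num_bound(2) by linarith
    qed
    moreover have "c1 \<le> infsum (Den \<epsilon>) (idxK \<kappa> \<epsilon> \<times> UNIV)"
    proof -
      define K' where "K' = {k::int. \<bar>real_of_int k * h - a0\<bar> \<le> \<rho>}"
      have K': "finite K'" "2 * \<rho> / h - 1 \<le> real (card K')"
        using card_int_multiples_near[of h \<rho> a0] h \<rho> by (auto simp: K'_def)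
      have K'K: "K' \<subseteq> idxK \<kappa> \<epsilon>"
        unfolding K'_def idxK_def h_def[symmetric] using \<rho>(4) by auto
      \<comment> \<open>The lattice point that brings the kernel argument into
        \<open>[T, T + 1]\<close>, where the lower bound \<open>c0\<close> holds.\<close>
      define j where "j k = \<lfloor>t \<epsilon> k - T\<rfloor>" for k
      have Den_ge: "c0\<^sup>2 * ((m / 2)\<^sup>2 * h) \<le> Den \<epsilon> (k, j k)" if k: "k \<in> K'" for k
      proof -
        define a where "a = real_of_int k * h"
        define u where "u = t \<epsilon> k - real_of_int (j k)"
        define p where "p = pbar + real_of_int (j k) * \<epsilon>"
        have u: "T \<le> u" "u \<le> T + 1" unfolding u_def j_def by linarith+
        have a: "\<bar>a - a0\<bar> \<le> \<rho>" using k by (simp add: K'_def a_def)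
        have "u\<^sup>2 \<le> (T + 1)\<^sup>2" using u T by (intro power_mono) auto
        then have "c0 \<le> 1 / (2 * pi * u\<^sup>2)"
          unfolding c0_def using u T by (intro divide_left_mono mult_pos_pos) auto
        then have "c0 \<le> \<bar>\<psi> u\<bar>" using T(2)[OF u(1)] by linarith
        then have \<psi>: "c0\<^sup>2 \<le> (\<psi> u)\<^sup>2" using c0 by (metis abs_le_square_iff abs_of_pos)
        \<comment> \<open>The quotient by \<epsilon> in \<open>t\<close> cancels against the lattice
          position, leaving a bounded multiple of \<epsilon>.\<close>
        have "p - dirvec a \<bullet> x0 = \<epsilon> * (dirvec a \<bullet> xc - u)"
          using \<epsilon>(1) by (simp add: p_def u_def t_def a_def h_def field_simps)
        moreover have "\<bar>dirvec a \<bullet> xc - u\<bar> \<le> E"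
          using abs_dirvec_inner_le[of a xc] u T unfolding E_def by linarith
        ultimately have "\<bar>p - dirvec a \<bullet> x0\<bar> \<le> \<epsilon> * E" using \<epsilon>(1) by (simp add: abs_mult)
        moreover have "\<bar>dirvec a \<bullet> x0 - dirvec a0 \<bullet> x0\<bar> < d" using r(2) a \<rho>(2) by simp
        ultimately have "\<bar>a - a0\<bar> + \<bar>p - dirvec a0 \<bullet> x0\<bar> \<le> 3 * d"
          using a \<rho>(3) \<epsilon>E by linarith
        then have "L * (\<bar>a - a0\<bar> + \<bar>p - dirvec a0 \<bullet> x0\<bar>) \<le> L * (3 * d)"
          using L(1) by (intro mult_left_mono) auto
        also have "L * (3 * d) = m / 2" using L(1) by (simp add: d_def)
        finally have "\<bar>\<sigma> a p - \<sigma> a0 (dirvec a0 \<bullet> x0)\<bar> \<le> m / 2"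
          using L(2)[of a p a0 "dirvec a0 \<bullet> x0"] by linarith
        then have "m / 2 \<le> \<bar>\<sigma> a p\<bar>" unfolding m_def by linarith
        then have "(m / 2)\<^sup>2 \<le> \<bar>\<sigma> a p\<bar>\<^sup>2" using m by (intro power_mono) auto
        then have "c0\<^sup>2 * ((m / 2)\<^sup>2 * h) \<le> (\<psi> u)\<^sup>2 * ((\<sigma> a p)\<^sup>2 * h)"
          using \<psi> h by (intro mult_mono) auto
        then show ?thesis
          using var[of k "j k"] k K'K by (auto simp: Den_def u_def p_def a_def)
      qed
      \<comment> \<open>Here \<open>h \<le> \<rho>\<close> absorbs the 1 lost to rounding.\<close>
      have "\<rho> / h \<le> 2 * \<rho> / h - 1" using h by (simp add: field_simps)
      then have "\<rho> / h * (c0\<^sup>2 * ((m / 2)\<^sup>2 * h)) \<le> real (card K') * (c0\<^sup>2 * ((m / 2)\<^sup>2 * h))"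
        using K'(2) h by (intro mult_right_mono) auto
      moreover have "\<rho> / h * (c0\<^sup>2 * ((m / 2)\<^sup>2 * h)) = c1" using h by (simp add: c1_def)
      ultimately have "c1 \<le> real (card K') * (c0\<^sup>2 * ((m / 2)\<^sup>2 * h))" by simp
      also have "\<dots> \<le> (\<Sum>k\<in>K'. Den \<epsilon> (k, j k))"
        using sum_mono[OF Den_ge, of K' "\<lambda>k. k"] by simp
      \<comment> \<open>The chosen pairs have distinct first components, so they form a finite
        subfamily whose sum is below the infinite one.\<close>
      also have "\<dots> = sum (Den \<epsilon>) ((\<lambda>k. (k, j k)) ` K')"
        by (subst sum.reindex) (auto simp: inj_on_def)
      also have "\<dots> \<le> infsum (Den \<epsilon>) (idxK \<kappa> \<epsilon> \<times> UNIV)"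
        by (rule finite_sum_le_infsum[OF Den_bound(1)]) (use K' K'K Den_nonneg in auto)
      finally show ?thesis .
    qed
    moreover have "0 \<le> infsum (Num \<epsilon>) (idxK \<kappa> \<epsilon> \<times> UNIV)"
      by (rule infsum_nonneg) (use Num_nonneg in auto)
    ultimately show ?thesis using Num_bound(1) Den_bound(1) by (simp add: h_def)
  qed

  \<comment> \<open>The quotient as \<epsilon> tends to 0\<close>
  have ev: "\<forall>\<^sub>F \<epsilon> in at_right 0. 0 < \<epsilon> \<and> \<epsilon> < \<epsilon>0"
    using eventually_at_right_real[OF \<epsilon>0] by eventually_elim auto
  have "\<forall>\<^sub>F \<epsilon> in at_right 0. Num \<epsilon> summable_on (idxK \<kappa> \<epsilon> \<times> UNIV) \<and>
      Den \<epsilon> summable_on (idxK \<kappa> \<epsilon> \<times> UNIV)"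
    using ev by eventually_elim (use main in blast)
  moreover have "(\<lambda>\<epsilon>. infsum (Num \<epsilon>) (idxK \<kappa> \<epsilon> \<times> UNIV)
      / (infsum (Den \<epsilon>) (idxK \<kappa> \<epsilon> \<times> UNIV)) powr (3/2)) \<in> O[at_right 0](\<lambda>\<epsilon>. sqrt \<epsilon>)"
  proof (rule bigoI)
    show "\<forall>\<^sub>F \<epsilon> in at_right 0. norm (infsum (Num \<epsilon>) (idxK \<kappa> \<epsilon> \<times> UNIV)
        / (infsum (Den \<epsilon>) (idxK \<kappa> \<epsilon> \<times> UNIV)) powr (3/2))
        \<le> c2 * sqrt \<kappa> / c1 powr (3/2) * norm (sqrt \<epsilon>)"
      using ev
    proof eventually_elim
      case (elim \<epsilon>)
      define N where "N = infsum (Num \<epsilon>) (idxK \<kappa> \<epsilon> \<times> UNIV)"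
      define D where "D = infsum (Den \<epsilon>) (idxK \<kappa> \<epsilon> \<times> UNIV)"
      have ND: "0 \<le> N" "N \<le> c2 * sqrt (\<kappa> * \<epsilon>)" "c1 \<le> D"
        using main[of \<epsilon>] elim by (auto simp: N_def D_def)
      have "c1 powr (3/2) \<le> D powr (3/2)" using ND c1 by (intro powr_mono2) auto
      then have "N / D powr (3/2) \<le> (c2 * sqrt (\<kappa> * \<epsilon>)) / c1 powr (3/2)"
        using ND c1 by (intro frac_le) auto
      then show ?case using ND elim
        by (simp add: real_sqrt_mult ac_simps flip: N_def D_def)
    qed
  qed
  \<comment> \<open>The goal subtracts \<open>j\<close> before adding the \<open>xc\<close> term;
    only the order of summands differs.\<close>
  moreover have "\<psi> (t \<epsilon> k - real_of_int j) = hilbert_transform (deriv \<phi>)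
      ((dirvec (real_of_int k * (\<kappa> * \<epsilon>)) \<bullet> x0 - pbar) / \<epsilon> - real_of_int j
        + dirvec (real_of_int k * (\<kappa> * \<epsilon>)) \<bullet> xc)" for \<epsilon> k j
    unfolding \<psi>_def t_def by (rule arg_cong[of _ _ "hilbert_transform (deriv \<phi>)"]) simp
  ultimately show ?thesis
    unfolding Let_def Num_def Den_def by simp
qed

end
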